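(* Consider a steady compressible gas in Euclidean space $\mathbb{R}^n$ with smooth mass density $\rho\ge0$, velocity field $u$ and pressure $p>0$, and let $A=\rho\,u\otimes u+p\,I$. Let $\theta$ be the angle between the velocity $u$ and the vector field $\nabla r$, where $r$ is the Euclidean distance to the origin. (a) If $n\ge3$ and $\cos^2(\theta)\le1/3$, then $\mathbb{R}^n$ is $A$-hyperbolic. (b) If $n=2$ and $\cos^2(\theta)\ge1/2$, then $\mathbb{R}^2$ is $A$-parabolic.
   Context: $\rho,u,p$ are time-independent and obey the (steady) Euler equations; consequently the symmetric tensor $A=\rho\,u\otimes u+p\,I$, regarded as a $(1,1)$-tensor field via the Euclidean metric ($A(X)=\rho\langle u,X\rangle u+pX$), is divergence-free. The angle condition means $\langle u,\nabla r\rangle^2\le\frac13|u|^2$, respectively $\langle u,\nabla r\rangle^2\ge\frac12|u|^2$, on $\mathbb{R}^n-\{0\}$. For a smooth self-adjoint positive definite $(1,1)$-tensor field $\mathcal{W}$ on a complete Riemannian manifold $M$, let $\Delta_{\mathcal{W}}v={\rm div}(\mathcal{W}(\nabla v))$; $M$ is $\mathcal{W}$-parabolic if every smooth function $v$ on $M$ bounded from above with $\Delta_{\mathcal{W}}v\ge0$ is constant, and $\mathcal{W}$-hyperbolic otherwise. "$A$-hyperbolic/parabolic" is this notion with $\mathcal{W}=A$. *)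

theory Defs
  imports "HOL-Analysis.Analysis"
begin

text \<open>On finite-dimensional domains this is the class \<open>C\<^sup>k\<close>: the recursion runs over the
  directional derivatives in all constant directions \<open>h\<close>.\<close>

fun Ck :: "nat \<Rightarrow> ('a::real_normed_vector \<Rightarrow> 'b::real_normed_vector) \<Rightarrow> bool" where
  "Ck 0 f \<longleftrightarrow> continuous_on UNIV f"
| "Ck (Suc k) f \<longleftrightarrow>
     (\<forall>x. f differentiable (at x)) \<and> (\<forall>h. Ck k (\<lambda>x. frechet_derivative f (at x) h))"

definition smooth :: "('a::real_normed_vector \<Rightarrow> 'b::real_normed_vector) \<Rightarrow> bool" where
  "smooth f \<longleftrightarrow> (\<forall>k. Ck k f)"

definition grad :: "('a::real_inner \<Rightarrow> real) \<Rightarrow> 'a \<Rightarrow> 'a" where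
  "grad f x = (THE D. GDERIV f x :> D)"

definition divergence :: "('a::euclidean_space \<Rightarrow> 'a) \<Rightarrow> 'a \<Rightarrow> real" where
  "divergence V x = (\<Sum>b\<in>Basis. frechet_derivative V (at x) b \<bullet> b)"

text \<open>A \<open>(1,1)\<close>-tensor field is a function \<open>T\<close> with \<open>T x\<close> the endomorphism at the point \<open>x\<close>.
  The \<open>b\<close>-component of the divergence of a self-adjoint \<open>T\<close> is the divergence of the vector
  field \<open>T b\<close>.\<close>

definition tensor_divergence :: "('a::euclidean_space \<Rightarrow> 'a \<Rightarrow> 'a) \<Rightarrow> 'a \<Rightarrow> 'a" where
  "tensor_divergence T x = (\<Sum>b\<in>Basis. divergence (\<lambda>y. T y b) x *\<^sub>R b)"

text \<open>Conservation of mass, \<open>div (\<rho> u) = 0\<close>, and of momentum,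
  \<open>div (\<rho> u \<otimes> u) + \<nabla>p = 0\<close>.\<close>

definition steady_euler ::
    "('a::euclidean_space \<Rightarrow> real) \<Rightarrow> ('a \<Rightarrow> 'a) \<Rightarrow> ('a \<Rightarrow> real) \<Rightarrow> bool" where
  "steady_euler \<rho> u p \<longleftrightarrow>
     (\<forall>x. divergence (\<lambda>y. \<rho> y *\<^sub>R u y) x = 0) \<and>
     (\<forall>x. tensor_divergence (\<lambda>y X. (\<rho> y * (u y \<bullet> X)) *\<^sub>R u y) x + grad p x = 0)"

definition gas_tensor ::
    "('a::real_inner \<Rightarrow> real) \<Rightarrow> ('a \<Rightarrow> 'a) \<Rightarrow> ('a \<Rightarrow> real) \<Rightarrow> 'a \<Rightarrow> 'a \<Rightarrow> 'a" where
  "gas_tensor \<rho> u p x X = (\<rho> x * (u x \<bullet> X)) *\<^sub>R u x + p x *\<^sub>R X"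

definition tensor_laplacian ::
    "('a::euclidean_space \<Rightarrow> 'a \<Rightarrow> 'a) \<Rightarrow> ('a \<Rightarrow> real) \<Rightarrow> 'a \<Rightarrow> real" where
  "tensor_laplacian W v = divergence (\<lambda>y. W y (grad v y))"

text \<open>The following two notions are meant for smooth, self-adjoint, positive definite \<open>W\<close>, as is
  \<open>gas_tensor \<rho> u p\<close> for smooth data with \<open>\<rho> \<ge> 0\<close> and \<open>p > 0\<close>.\<close>

definition parabolic :: "('a::euclidean_space \<Rightarrow> 'a \<Rightarrow> 'a) \<Rightarrow> bool" where
  "parabolic W \<longleftrightarrow>
     (\<forall>v::'a \<Rightarrow> real.
        smooth v \<and> bdd_above (range v) \<and> (\<forall>x. tensor_laplacian W v x \<ge> 0)
          \<longrightarrow> v constant_on UNIV)"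

definition hyperbolic :: "('a::euclidean_space \<Rightarrow> 'a \<Rightarrow> 'a) \<Rightarrow> bool" where
  "hyperbolic W \<longleftrightarrow> \<not> parabolic W"

end

theory Submission
  imports Defs
begin

text \<open>The momentum equation says that each field \<open>A b\<close>, \<open>b\<close> constant, is divergence-free. Hence the
  first-order part of \<open>div (A (\<nabla>v))\<close> vanishes, and
  \<open>\<Delta>\<^sub>A v = tr (A Hess v) = \<rho> D\<^sup>2v(u,u) + p \<Delta>v\<close> (lemma \<open>has_gas_operator_at_tensor_laplacian\<close>).
  For a function \<open>\<phi>(q)\<close> of \<open>q = |x|\<^sup>2\<close> this equals
  \<open>4 \<phi>'' (\<rho> \<langle>x,u\<rangle>\<^sup>2 + p q) + 2 \<phi>' (\<rho> |u|\<^sup>2 + n p)\<close> (lemma \<open>has_gas_operator_at_radial\<close>), so the angle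
  between \<open>u\<close> and \<open>x\<close> decides the sign for a suitable increasing concave \<open>\<phi>\<close>.

  If \<open>\<langle>x,u\<rangle>\<^sup>2 \<le> |x|\<^sup>2|u|\<^sup>2/3\<close> and \<open>n \<ge> 3\<close>, the operator behaves on radial functions at least as the
  Laplacian of \<open>\<real>\<^sup>3\<close>, and the bounded function \<open>- (1 + |x|\<^sup>2)\<^sup>-\<^sup>1\<^sup>/\<^sup>2\<close> is a nonconstant subsolution
  (lemma \<open>potential_subsolution\<close>).

  If \<open>\<langle>x,u\<rangle>\<^sup>2 \<ge> |x|\<^sup>2|u|\<^sup>2/2\<close> and \<open>n = 2\<close>, it behaves at most as the Laplacian of \<open>\<real>\<^sup>2\<close>;
  off a disc \<open>ln (ln |x|\<^sup>2)\<close> is a strict supersolution, and it tends to infinity. Subtracting a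
  small multiple of it from a subsolution \<open>v\<close> bounded above shows that \<open>v\<close> is nowhere larger than
  its maximum on a fixed disc (lemma \<open>bounded_subsolution_attains_max\<close>). So \<open>v\<close> attains a global
  maximum, and Hopf's argument makes it constant (lemma \<open>strong_maximum_principle\<close>).\<close>

section \<open>Second derivatives along lines\<close>

text \<open>The derivative is taken along the line \<open>z + t h\<close> for small \<open>t\<close> only, so that functions which are
  smooth merely near \<open>z\<close>, such as \<open>ln (ln |x|\<^sup>2)\<close>, are covered, and so that the second derivative test
  is the one for functions of a real variable.\<close>

definition has_second_dir_deriv :: "('a::real_normed_vector \<Rightarrow> real) \<Rightarrow> 'a \<Rightarrow> 'a \<Rightarrow> real \<Rightarrow> bool" where
  "has_second_dir_deriv w z h c \<longleftrightarrow>
     (\<exists>g' d. d > 0 \<and> (\<forall>t. \<bar>t\<bar> < d \<longrightarrow> DERIV (\<lambda>t. w (z + t *\<^sub>R h)) t :> g' t) \<and> DERIV g' 0 :> c)"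

lemma has_second_dir_derivE:
  assumes "has_second_dir_deriv w z h c"
  obtains g' d where "d > 0" "\<And>t. \<bar>t\<bar> < d \<Longrightarrow> DERIV (\<lambda>t. w (z + t *\<^sub>R h)) t :> g' t"
    "DERIV g' 0 :> c"
  using assms unfolding has_second_dir_deriv_def by blast

lemma has_second_dir_deriv_unique:
  assumes "has_second_dir_deriv w z h c" "has_second_dir_deriv w z h c'"
  shows "c = c'"
proof -
  obtain f d where f: "d > 0" "\<And>t. \<bar>t\<bar> < d \<Longrightarrow> DERIV (\<lambda>t. w (z + t *\<^sub>R h)) t :> f t" "DERIV f 0 :> c"
    using assms(1) by (rule has_second_dir_derivE) blast
  obtain g e where g: "e > 0" "\<And>t. \<bar>t\<bar> < e \<Longrightarrow> DERIV (\<lambda>t. w (z + t *\<^sub>R h)) t :> g t" "DERIV g 0 :> c'"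
    using assms(2) by (rule has_second_dir_derivE) blast
  have "DERIV g 0 :> c"
  proof (rule has_field_derivative_transform_within[OF f(3)])
    show "0 < min d e" using f g by simp
    show "f t = g t" if "dist t 0 < min d e" for t
      using that f(2)[of t] g(2)[of t] DERIV_unique by auto
  qed simp
  then show ?thesis using g(3) DERIV_unique by blast
qed

lemma has_second_dir_deriv_add:
  assumes "has_second_dir_deriv v z h a" "has_second_dir_deriv w z h b"
  shows "has_second_dir_deriv (\<lambda>x. v x + w x) z h (a + b)"
proof -
  obtain f d where f: "d > 0" "\<And>t. \<bar>t\<bar> < d \<Longrightarrow> DERIV (\<lambda>t. v (z + t *\<^sub>R h)) t :> f t" "DERIV f 0 :> a"
    using assms(1) by (rule has_second_dir_derivE) blast
  obtain g e where g: "e > 0" "\<And>t. \<bar>t\<bar> < e \<Longrightarrow> DERIV (\<lambda>t. w (z + t *\<^sub>R h)) t :> g t" "DERIV g 0 :> b"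
    using assms(2) by (rule has_second_dir_derivE) blast
  show ?thesis unfolding has_second_dir_deriv_def
    by (rule exI[of _ "\<lambda>t. f t + g t"], rule exI[of _ "min d e"])
      (use f g in \<open>auto intro!: DERIV_add\<close>)
qed

lemma has_second_dir_deriv_cmult:
  assumes "has_second_dir_deriv w z h a"
  shows "has_second_dir_deriv (\<lambda>x. k * w x) z h (k * a)"
proof -
  obtain f d where f: "d > 0" "\<And>t. \<bar>t\<bar> < d \<Longrightarrow> DERIV (\<lambda>t. w (z + t *\<^sub>R h)) t :> f t" "DERIV f 0 :> a"
    using assms(1) by (rule has_second_dir_derivE) blast
  show ?thesis unfolding has_second_dir_deriv_def
    by (rule exI[of _ "\<lambda>t. k * f t"], rule exI[of _ d])
      (use f in \<open>auto intro!: DERIV_cmult\<close>)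
qed

text \<open>If the second derivative were positive, then the first derivative, which vanishes at the maximum,
  would be positive just to the right of it, and \<open>w\<close> would increase along the line.\<close>

lemma second_dir_deriv_local_max_le_0:
  assumes "has_second_dir_deriv w z h c" and max: "\<forall>\<^sub>F x in nhds z. w x \<le> w z"
  shows "c \<le> 0"
proof (rule ccontr)
  assume "\<not> c \<le> 0"
  obtain g d where g: "d > 0" "\<And>t. \<bar>t\<bar> < d \<Longrightarrow> DERIV (\<lambda>t. w (z + t *\<^sub>R h)) t :> g t" "DERIV g 0 :> c"
    using assms(1) by (rule has_second_dir_derivE) blast
  have "((\<lambda>t. z + t *\<^sub>R h) \<longlongrightarrow> z + 0 *\<^sub>R h) (nhds 0)"
    by (intro tendsto_intros filterlim_ident)
  then have "\<forall>\<^sub>F t in nhds 0. w (z + t *\<^sub>R h) \<le> w z"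
    using max by (auto dest: eventually_compose_filterlim)
  then obtain e where e: "e > 0" "\<And>t. \<bar>t\<bar> < e \<Longrightarrow> w (z + t *\<^sub>R h) \<le> w z"
    unfolding eventually_nhds_metric dist_real_def by auto
  have "g 0 = 0"
    by (rule DERIV_local_max[OF g(2) e(1)]) (use g(1) e(2) in auto)
  then obtain d' where d': "d' > 0" "\<And>t. 0 < t \<Longrightarrow> t < d' \<Longrightarrow> g t > 0"
    using DERIV_pos_inc_right[OF g(3)] \<open>\<not> c \<le> 0\<close> by auto
  define t where "t = min d (min d' e) / 2"
  have t: "0 < t" "t < d" "t < d'" "t < e" using g(1) d'(1) e(1) by (auto simp: t_def)
  have "\<exists>s. 0 < s \<and> s < t \<and> w (z + t *\<^sub>R h) - w (z + 0 *\<^sub>R h) = (t - 0) * g s"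
    by (rule MVT2) (use t g(2) in auto)
  then obtain s where "0 < s" "s < t" "w (z + t *\<^sub>R h) - w z = t * g s" by auto
  moreover have "t * g s > 0" using d'(2)[of s] calculation t by simp
  ultimately show False using e(2)[of t] t by simp
qed

text \<open>Along a line \<open>|x - y|\<^sup>2\<close> is a quadratic polynomial in \<open>t\<close>; the chain rule does the rest.\<close>

lemma has_second_dir_deriv_radial:
  fixes y z h :: "'a::real_inner"
  assumes "open S" "(norm (z - y))\<^sup>2 \<in> S" "\<And>s. s \<in> S \<Longrightarrow> DERIV \<phi> s :> \<phi>' s"
    and "DERIV \<phi>' ((norm (z - y))\<^sup>2) :> \<phi>''"
  shows "has_second_dir_deriv (\<lambda>x. \<phi> ((norm (x - y))\<^sup>2)) z h
    (4 * \<phi>'' * ((z - y) \<bullet> h)\<^sup>2 + 2 * \<phi>' ((norm (z - y))\<^sup>2) * (norm h)\<^sup>2)"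
proof -
  define q where "q t = (norm (z - y))\<^sup>2 + 2 * ((z - y) \<bullet> h) * t + (norm h)\<^sup>2 * t\<^sup>2" for t
  have q: "(norm (z + t *\<^sub>R h - y))\<^sup>2 = q t" for t
    unfolding q_def power2_norm_eq_inner
    by (simp add: inner_simps inner_commute power2_eq_square algebra_simps)
  have q0: "q 0 = (norm (z - y))\<^sup>2" by (simp add: q_def)
  have dq: "DERIV q t :> 2 * ((z - y) \<bullet> h) + 2 * (norm h)\<^sup>2 * t" for t
    unfolding q_def by (auto intro!: derivative_eq_intros)
  have "isCont q 0" using dq DERIV_isCont by blast
  then have "\<forall>\<^sub>F t in nhds 0. q t \<in> S"
    using assms(1,2) q0 by (simp add: isCont_def tendsto_def eventually_nhds_conv_at)
  then obtain d where d: "d > 0" "\<And>t. \<bar>t\<bar> < d \<Longrightarrow> q t \<in> S"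
    unfolding eventually_nhds_metric dist_real_def by auto
  have deriv1: "DERIV (\<lambda>t. \<phi> (q t)) t :> \<phi>' (q t) * (2 * ((z - y) \<bullet> h) + 2 * (norm h)\<^sup>2 * t)"
    if "\<bar>t\<bar> < d" for t
    by (rule DERIV_chain2[OF assms(3)[OF d(2)[OF that]] dq])
  have "DERIV (\<lambda>t. \<phi>' (q t)) 0 :> \<phi>'' * (2 * ((z - y) \<bullet> h) + 2 * (norm h)\<^sup>2 * 0)"
    by (rule DERIV_chain2[OF _ dq]) (use assms(4) q0 in simp)
  moreover have "DERIV (\<lambda>t. 2 * ((z - y) \<bullet> h) + 2 * (norm h)\<^sup>2 * t) 0 :> 2 * (norm h)\<^sup>2"
    by (auto intro!: derivative_eq_intros)
  ultimately have "DERIV (\<lambda>t. \<phi>' (q t) * (2 * ((z - y) \<bullet> h) + 2 * (norm h)\<^sup>2 * t)) 0 :>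
     \<phi>'' * (2 * ((z - y) \<bullet> h) + 2 * (norm h)\<^sup>2 * 0) * (2 * ((z - y) \<bullet> h) + 2 * (norm h)\<^sup>2 * 0)
       + 2 * (norm h)\<^sup>2 * \<phi>' (q 0)"
    by (rule DERIV_mult)
  moreover have "\<phi>'' * (2 * ((z - y) \<bullet> h) + 2 * (norm h)\<^sup>2 * 0) * (2 * ((z - y) \<bullet> h) + 2 * (norm h)\<^sup>2 * 0)
       + 2 * (norm h)\<^sup>2 * \<phi>' (q 0)
     = 4 * \<phi>'' * ((z - y) \<bullet> h)\<^sup>2 + 2 * \<phi>' ((norm (z - y))\<^sup>2) * (norm h)\<^sup>2"
    by (simp add: q0 power2_eq_square)
  ultimately have "DERIV (\<lambda>t. \<phi>' (q t) * (2 * ((z - y) \<bullet> h) + 2 * (norm h)\<^sup>2 * t)) 0 :>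
     4 * \<phi>'' * ((z - y) \<bullet> h)\<^sup>2 + 2 * \<phi>' ((norm (z - y))\<^sup>2) * (norm h)\<^sup>2"
    by (rule DERIV_cong)
  with deriv1 d(1) show ?thesis
    unfolding has_second_dir_deriv_def q
    by (intro exI[where x = "\<lambda>t. \<phi>' (q t) * (2 * ((z - y) \<bullet> h) + 2 * (norm h)\<^sup>2 * t)"]
        exI[where x = d] conjI allI impI)
qed

section \<open>The second-order operator at a point\<close>

text \<open>The number \<open>l\<close> is \<open>tr (A Hess w)\<close> at \<open>z\<close> for \<open>A = r U \<otimes> U + P I\<close>. The coefficients are the values of
  \<open>\<rho>, u, p\<close> at the point. It is a relation in \<open>l\<close>, so that it also asserts that the second derivatives
  exist.\<close>

definition has_gas_operator_at ::
    "real \<Rightarrow> 'a::euclidean_space \<Rightarrow> real \<Rightarrow> ('a \<Rightarrow> real) \<Rightarrow> 'a \<Rightarrow> real \<Rightarrow> bool" where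
  "has_gas_operator_at r U P w z l \<longleftrightarrow>
     (\<exists>c. (\<forall>h. has_second_dir_deriv w z h (c h)) \<and> l = r * c U + P * (\<Sum>b\<in>Basis. c b))"

lemma has_gas_operator_at_unique:
  assumes "has_gas_operator_at r U P w z l" "has_gas_operator_at r U P w z l'"
  shows "l = l'"
proof -
  obtain c c' where "\<And>h. has_second_dir_deriv w z h (c h)" "\<And>h. has_second_dir_deriv w z h (c' h)"
    and l: "l = r * c U + P * (\<Sum>b\<in>Basis. c b)" "l' = r * c' U + P * (\<Sum>b\<in>Basis. c' b)"
    using assms unfolding has_gas_operator_at_def by blast
  then have "c = c'" using has_second_dir_deriv_unique by blast
  with l show ?thesis by simp
qed

lemma has_gas_operator_at_add_cmult:
  assumes "has_gas_operator_at r U P v z l" "has_gas_operator_at r U P w z m"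
  shows "has_gas_operator_at r U P (\<lambda>x. v x + k * w x) z (l + k * m)"
proof -
  obtain c c' where *: "\<And>h. has_second_dir_deriv v z h (c h)" "\<And>h. has_second_dir_deriv w z h (c' h)"
    and l: "l = r * c U + P * (\<Sum>b\<in>Basis. c b)" "m = r * c' U + P * (\<Sum>b\<in>Basis. c' b)"
    using assms unfolding has_gas_operator_at_def by blast
  show ?thesis unfolding has_gas_operator_at_def
    by (rule exI[of _ "\<lambda>h. c h + k * c' h"])
      (auto simp: l sum.distrib sum_distrib_left algebra_simps
        intro!: has_second_dir_deriv_add has_second_dir_deriv_cmult *)
qed

lemma gas_operator_local_max_le_0:
  assumes "has_gas_operator_at r U P w z l" "r \<ge> 0" "P \<ge> 0" "\<forall>\<^sub>F x in nhds z. w x \<le> w z"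
  shows "l \<le> 0"
proof -
  obtain c where c: "\<And>h. has_second_dir_deriv w z h (c h)" and l: "l = r * c U + P * (\<Sum>b\<in>Basis. c b)"
    using assms(1) unfolding has_gas_operator_at_def by blast
  have "c h \<le> 0" for h using second_dir_deriv_local_max_le_0[OF c assms(4)] .
  then show ?thesis
    using assms(2,3) by (simp add: l add_nonpos_nonpos mult_nonneg_nonpos sum_nonpos)
qed

text \<open>The \<open>\<phi>''\<close> part of the Hessian acts on the radial direction alone, which gives
  \<open>r \<langle>z - y, U\<rangle>\<^sup>2 + P |z - y|\<^sup>2\<close>; the \<open>\<phi>'\<close> part is a multiple of the identity, which gives the trace
  \<open>r |U|\<^sup>2 + n P\<close>.\<close>

lemma has_gas_operator_at_radial:
  fixes y z :: "'a::euclidean_space"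
  assumes "open S" "(norm (z - y))\<^sup>2 \<in> S" "\<And>s. s \<in> S \<Longrightarrow> DERIV \<phi> s :> \<phi>' s"
    and "DERIV \<phi>' ((norm (z - y))\<^sup>2) :> \<phi>''"
  shows "has_gas_operator_at r U P (\<lambda>x. \<phi> ((norm (x - y))\<^sup>2)) z
    (4 * \<phi>'' * (r * ((z - y) \<bullet> U)\<^sup>2 + P * (norm (z - y))\<^sup>2)
      + 2 * \<phi>' ((norm (z - y))\<^sup>2) * (r * (norm U)\<^sup>2 + P * DIM('a)))"
proof -
  have "(\<Sum>b\<in>Basis. ((z - y) \<bullet> b)\<^sup>2) = (norm (z - y))\<^sup>2"
    unfolding power2_norm_eq_inner euclidean_inner[of "z - y" "z - y"] by (simp add: power2_eq_square)
  then have S: "(\<Sum>b\<in>Basis. 4 * \<phi>'' * ((z - y) \<bullet> b)\<^sup>2) = 4 * \<phi>'' * (norm (z - y))\<^sup>2"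
    by (simp flip: sum_distrib_left)
  have l: "4 * \<phi>'' * (r * ((z - y) \<bullet> U)\<^sup>2 + P * (norm (z - y))\<^sup>2)
      + 2 * \<phi>' ((norm (z - y))\<^sup>2) * (r * (norm U)\<^sup>2 + P * DIM('a))
    = r * (4 * \<phi>'' * ((z - y) \<bullet> U)\<^sup>2 + 2 * \<phi>' ((norm (z - y))\<^sup>2) * (norm U)\<^sup>2)
      + P * (\<Sum>b\<in>Basis. 4 * \<phi>'' * ((z - y) \<bullet> b)\<^sup>2 + 2 * \<phi>' ((norm (z - y))\<^sup>2) * (norm b)\<^sup>2)"
    unfolding sum.distrib S by (simp add: algebra_simps)
  show ?thesis unfolding has_gas_operator_at_def
    by (rule exI[of _ "\<lambda>h. 4 * \<phi>'' * ((z - y) \<bullet> h)\<^sup>2 + 2 * \<phi>' ((norm (z - y))\<^sup>2) * (norm h)\<^sup>2"])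
      (intro conjI allI l has_second_dir_deriv_radial[OF assms])
qed

section \<open>The Laplacian of the gas tensor in non-divergence form\<close>

lemma Ck_SucD: "Ck (Suc k) f \<Longrightarrow> Ck k f"
proof (induction k arbitrary: f)
  case 0
  then show ?case
    by (simp add: continuous_on_eq_continuous_within differentiable_imp_continuous_within)
next
  case (Suc k)
  have "\<forall>x. f differentiable (at x)" "\<forall>h. Ck (Suc k) (\<lambda>x. frechet_derivative f (at x) h)"
    using Suc.prems unfolding Ck.simps(2)[of "Suc k"] by simp_all
  then show ?case unfolding Ck.simps(2)[of k] using Suc.IH by simp
qed

lemma smooth_differentiable: "smooth f \<Longrightarrow> f differentiable (at x)"
proof -
  assume "smooth f"
  then have "Ck (Suc 0) f" unfolding smooth_def ..
  then show ?thesis by simp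
qed

lemma smooth_frechet_derivative: "smooth f \<Longrightarrow> smooth (\<lambda>x. frechet_derivative f (at x) h)"
proof (unfold smooth_def, rule allI)
  fix k assume "\<forall>k. Ck k f"
  then have "Ck (Suc k) f" ..
  then show "Ck k (\<lambda>x. frechet_derivative f (at x) h)" by simp
qed

lemma grad_eqI:
  assumes "GDERIV f x :> D" shows "grad f x = D"
  unfolding grad_def
proof (rule the_equality)
  show "GDERIV f x :> D" by (rule assms)
next
  fix E assume "GDERIV f x :> E"
  then have "(\<lambda>h. h \<bullet> E) = (\<lambda>h. h \<bullet> D)"
    using assms unfolding gderiv_def by (rule has_derivative_unique)
  then show "E = D" by (metis inner_commute vector_eq_rdot)
qed

lemma grad_eq:
  fixes f :: "'a::euclidean_space \<Rightarrow> real"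
  assumes "f differentiable (at x)"
  shows "grad f x = (\<Sum>b\<in>Basis. frechet_derivative f (at x) b *\<^sub>R b)"
proof (rule grad_eqI)
  have d: "(f has_derivative frechet_derivative f (at x)) (at x)"
    using assms by (simp add: frechet_derivative_works)
  interpret linear "frechet_derivative f (at x)"
    using d has_derivative_linear by blast
  have "frechet_derivative f (at x) h = h \<bullet> (\<Sum>b\<in>Basis. frechet_derivative f (at x) b *\<^sub>R b)" for h
  proof -
    have "frechet_derivative f (at x) h = frechet_derivative f (at x) (\<Sum>b\<in>Basis. (h \<bullet> b) *\<^sub>R b)"
      by (simp add: euclidean_representation)
    also have "\<dots> = (\<Sum>b\<in>Basis. (h \<bullet> b) * frechet_derivative f (at x) b)"
      by (simp add: sum scale)
    finally show ?thesis by (simp add: inner_sum_right mult.commute)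
  qed
  then have eq: "frechet_derivative f (at x)
      = (\<lambda>h. h \<bullet> (\<Sum>b\<in>Basis. frechet_derivative f (at x) b *\<^sub>R b))"
    by (rule ext)
  show "GDERIV f x :> (\<Sum>b\<in>Basis. frechet_derivative f (at x) b *\<^sub>R b)"
    unfolding gderiv_def by (rule has_derivative_eq_rhs[OF d eq])
qed

text \<open>The product rule \<open>div (f V) = \<langle>\<nabla>f, V\<rangle> + f div V\<close>, summed: applied to \<open>A (\<nabla>v) = \<Sum>\<^sub>e \<partial>\<^sub>e v A e\<close> it
  separates the second derivatives of \<open>v\<close> from the divergences of the columns of \<open>A\<close>.\<close>

lemma divergence_scaleR_sum:
  fixes V :: "'i \<Rightarrow> 'a::euclidean_space \<Rightarrow> 'a"
  assumes "\<And>i. i \<in> I \<Longrightarrow> f i differentiable (at x)" "\<And>i. i \<in> I \<Longrightarrow> V i differentiable (at x)"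
  shows "divergence (\<lambda>y. \<Sum>i\<in>I. f i y *\<^sub>R V i y) x
    = (\<Sum>i\<in>I. (\<Sum>b\<in>Basis. frechet_derivative (f i) (at x) b * (V i x \<bullet> b)) + f i x * divergence (V i) x)"
proof -
  have "((\<lambda>y. \<Sum>i\<in>I. f i y *\<^sub>R V i y) has_derivative
     (\<lambda>h. \<Sum>i\<in>I. f i x *\<^sub>R frechet_derivative (V i) (at x) h + frechet_derivative (f i) (at x) h *\<^sub>R V i x)) (at x)"
    by (intro has_derivative_sum has_derivative_scaleR) (use assms frechet_derivative_works in blast)+
  then have "frechet_derivative (\<lambda>y. \<Sum>i\<in>I. f i y *\<^sub>R V i y) (at x)
     = (\<lambda>h. \<Sum>i\<in>I. f i x *\<^sub>R frechet_derivative (V i) (at x) h + frechet_derivative (f i) (at x) h *\<^sub>R V i x)"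
    by (rule frechet_derivative_at[symmetric])
  then have "divergence (\<lambda>y. \<Sum>i\<in>I. f i y *\<^sub>R V i y) x
     = (\<Sum>b\<in>Basis. \<Sum>i\<in>I. f i x * (frechet_derivative (V i) (at x) b \<bullet> b) + frechet_derivative (f i) (at x) b * (V i x \<bullet> b))"
    unfolding divergence_def by (simp add: inner_sum_left inner_add_left)
  also have "\<dots> = (\<Sum>i\<in>I. \<Sum>b\<in>Basis. f i x * (frechet_derivative (V i) (at x) b \<bullet> b) + frechet_derivative (f i) (at x) b * (V i x \<bullet> b))"
    by (rule sum.swap)
  finally show ?thesis
    by (simp add: divergence_def sum.distrib sum_distrib_left)
qed

text \<open>The divergence of the column \<open>A e\<close> is the \<open>e\<close>-component of
  \<open>div (\<rho> u \<otimes> u) + \<nabla>p\<close>, which the momentum equation sets to zero.\<close>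

lemma divergence_gas_tensor_eq_0:
  fixes u :: "'a::euclidean_space \<Rightarrow> 'a"
  assumes "smooth \<rho>" "smooth u" "smooth p" "steady_euler \<rho> u p" "e \<in> Basis"
  shows "(\<lambda>y. gas_tensor \<rho> u p y e) differentiable (at x)"
    and "divergence (\<lambda>y. gas_tensor \<rho> u p y e) x = 0"
proof -
  note sd = assms(1-3)[THEN smooth_differentiable, of x]
  have "(\<lambda>y. u y \<bullet> e) differentiable (at x)"
    by (rule differentiable_inner[OF sd(2) differentiable_const])
  then have "(\<lambda>y. \<rho> y * (u y \<bullet> e)) differentiable (at x)"
    by (rule differentiable_mult[OF sd(1)])
  from differentiable_scaleR[OF this sd(2)] differentiable_scaleR[OF sd(3) differentiable_const]
  have d: "(\<lambda>y. (\<rho> y * (u y \<bullet> e)) *\<^sub>R u y) differentiable (at x)"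
      "(\<lambda>y. p y *\<^sub>R e) differentiable (at x)" .
  then show "(\<lambda>y. gas_tensor \<rho> u p y e) differentiable (at x)"
    unfolding gas_tensor_def by (rule differentiable_add)
  have p: "divergence (\<lambda>y. p y *\<^sub>R e) x = grad p x \<bullet> e"
    using divergence_scaleR_sum[of "{()}" "\<lambda>_. p" x "\<lambda>_ _. e"] sd(3) assms(5)
    by (simp add: grad_eq inner_sum_left divergence_def inner_commute[of e])
  \<comment> \<open>Additivity of the divergence is the case of two summands with coefficients \<open>1\<close>.\<close>
  have "divergence (\<lambda>y. gas_tensor \<rho> u p y e) x
    = divergence (\<lambda>y. (\<rho> y * (u y \<bullet> e)) *\<^sub>R u y) x + divergence (\<lambda>y. p y *\<^sub>R e) x"
    using divergence_scaleR_sum[of UNIV "\<lambda>_ _. 1" x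
        "\<lambda>b. if b then (\<lambda>y. (\<rho> y * (u y \<bullet> e)) *\<^sub>R u y) else (\<lambda>y. p y *\<^sub>R e)"] d
    by (simp add: UNIV_bool gas_tensor_def add.commute)
  also have "\<dots> = (tensor_divergence (\<lambda>y X. (\<rho> y * (u y \<bullet> X)) *\<^sub>R u y) x + grad p x) \<bullet> e"
    using assms(5) by (simp add: p inner_add_left tensor_divergence_def inner_sum_left inner_Basis if_distrib cong: if_cong)
  also have "\<dots> = 0" using assms(4) by (simp add: steady_euler_def)
  finally show "divergence (\<lambda>y. gas_tensor \<rho> u p y e) x = 0" .
qed

lemma has_second_dir_deriv_smooth:
  assumes "smooth v"
  shows "has_second_dir_deriv v z h (frechet_derivative (\<lambda>y. frechet_derivative v (at y) h) (at z) h)"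
proof -
  have *: "DERIV (\<lambda>t. f (z + t *\<^sub>R h)) t :> frechet_derivative f (at (z + t *\<^sub>R h)) h"
    if "smooth f" for f t
  proof -
    have f: "(f has_derivative frechet_derivative f (at (z + t *\<^sub>R h))) (at (z + t *\<^sub>R h))"
      using smooth_differentiable[OF that] frechet_derivative_works by blast
    have "((\<lambda>t. z + t *\<^sub>R h) has_derivative (\<lambda>s. s *\<^sub>R h)) (at t)"
      by (auto intro!: derivative_eq_intros)
    note deriv = has_derivative_compose[OF this f]
    have eq: "(\<lambda>s. frechet_derivative f (at (z + t *\<^sub>R h)) (s *\<^sub>R h))
        = (*) (frechet_derivative f (at (z + t *\<^sub>R h)) h)"
      by (rule ext) (simp add: linear_cmul[OF has_derivative_linear[OF f]])
    show ?thesis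
      unfolding has_field_derivative_def by (rule has_derivative_eq_rhs[OF deriv eq])
  qed
  show ?thesis unfolding has_second_dir_deriv_def
    by (rule exI[of _ "\<lambda>t. frechet_derivative v (at (z + t *\<^sub>R h)) h"], rule exI[of _ 1])
      (use *[OF assms] *[OF smooth_frechet_derivative[OF assms], of h 0] in simp)
qed

text \<open>Expand \<open>\<nabla>v\<close> in the standard basis. As the columns of \<open>A\<close> are divergence-free, only the terms with
  second derivatives of \<open>v\<close> survive in \<open>div (A (\<nabla>v))\<close>, and these form \<open>tr (A Hess v)\<close>.\<close>

lemma has_gas_operator_at_tensor_laplacian:
  fixes u :: "'a::euclidean_space \<Rightarrow> 'a"
  assumes s: "smooth \<rho>" "smooth u" "smooth p" "steady_euler \<rho> u p" and v: "smooth v"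
  shows "has_gas_operator_at (\<rho> x) (u x) (p x) v x (tensor_laplacian (gas_tensor \<rho> u p) v x)"
proof -
  define H where "H h k = frechet_derivative (\<lambda>y. frechet_derivative v (at y) h) (at x) k" for h k
  have dv: "(v has_derivative frechet_derivative v (at y)) (at y)" for y
    using smooth_differentiable[OF v] frechet_derivative_works by blast
  have ddv: "((\<lambda>y. frechet_derivative v (at y) h) has_derivative H h) (at x)" for h
    using smooth_differentiable[OF smooth_frechet_derivative[OF v]] frechet_derivative_works
    unfolding H_def by blast
  \<comment> \<open>The second derivative \<open>H\<close> is linear in either argument.\<close>
  have H1: "H h k = (\<Sum>b\<in>Basis. (k \<bullet> b) * H h b)" for h k
  proof -
    interpret linear "H h" using ddv has_derivative_linear by blast
    have "H h k = H h (\<Sum>b\<in>Basis. (k \<bullet> b) *\<^sub>R b)" by (simp add: euclidean_representation)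
    then show ?thesis by (simp add: sum scale)
  qed
  have H2: "H h k = (\<Sum>b\<in>Basis. (h \<bullet> b) * H b k)" for h k
  proof -
    have "frechet_derivative v (at y) h = (\<Sum>b\<in>Basis. (h \<bullet> b) * frechet_derivative v (at y) b)" for y
    proof -
      interpret linear "frechet_derivative v (at y)" using dv has_derivative_linear by blast
      have "frechet_derivative v (at y) h = frechet_derivative v (at y) (\<Sum>b\<in>Basis. (h \<bullet> b) *\<^sub>R b)"
        by (simp add: euclidean_representation)
      then show ?thesis by (simp add: sum scale)
    qed
    then have "(\<lambda>y. frechet_derivative v (at y) h) = (\<lambda>y. \<Sum>b\<in>Basis. (h \<bullet> b) * frechet_derivative v (at y) b)"
      by (rule ext)
    moreover have "((\<lambda>y. \<Sum>b\<in>Basis. (h \<bullet> b) * frechet_derivative v (at y) b) has_derivative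
        (\<lambda>k. \<Sum>b\<in>Basis. (h \<bullet> b) * H b k)) (at x)"
      by (intro has_derivative_sum has_derivative_mult_right ddv)
    ultimately have "((\<lambda>y. frechet_derivative v (at y) h) has_derivative (\<lambda>k. \<Sum>b\<in>Basis. (h \<bullet> b) * H b k)) (at x)"
      by (simp only:)
    from has_derivative_unique[OF this ddv] show ?thesis by (rule fun_cong[symmetric])
  qed
  have "gas_tensor \<rho> u p y (grad v y) = (\<Sum>e\<in>Basis. frechet_derivative v (at y) e *\<^sub>R gas_tensor \<rho> u p y e)" for y
    using smooth_differentiable[OF v]
    by (simp add: grad_eq gas_tensor_def inner_sum_right scaleR_sum_right scaleR_sum_left sum_distrib_left
        scaleR_add_right sum.distrib mult_ac)
  then have "tensor_laplacian (gas_tensor \<rho> u p) v x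
    = divergence (\<lambda>y. \<Sum>e\<in>Basis. frechet_derivative v (at y) e *\<^sub>R gas_tensor \<rho> u p y e) x"
    unfolding tensor_laplacian_def by simp
  also have "\<dots> = (\<Sum>e\<in>Basis. \<Sum>b\<in>Basis. H e b * (gas_tensor \<rho> u p x e \<bullet> b))"
    using divergence_gas_tensor_eq_0[OF s]
    by (subst divergence_scaleR_sum)
      (auto simp: H_def smooth_differentiable[OF smooth_frechet_derivative[OF v]])
  also have "\<dots> = (\<Sum>e\<in>Basis. \<Sum>b\<in>Basis. \<rho> x * ((u x \<bullet> e) * ((u x \<bullet> b) * H e b)) + p x * (H e b * (e \<bullet> b)))"
    by (simp add: gas_tensor_def inner_add_left algebra_simps)
  also have "\<dots> = \<rho> x * (\<Sum>e\<in>Basis. (u x \<bullet> e) * (\<Sum>b\<in>Basis. (u x \<bullet> b) * H e b))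
     + p x * (\<Sum>e\<in>Basis. \<Sum>b\<in>Basis. H e b * (e \<bullet> b))"
    by (simp add: sum.distrib sum_distrib_left)
  also have "(\<Sum>e\<in>Basis. (u x \<bullet> e) * (\<Sum>b\<in>Basis. (u x \<bullet> b) * H e b)) = H (u x) (u x)"
    unfolding H1[symmetric] H2[symmetric] ..
  also have "(\<Sum>e\<in>Basis. \<Sum>b\<in>Basis. H e b * (e \<bullet> b)) = (\<Sum>b\<in>Basis. H b b)"
    by (rule sum.cong) (simp_all add: inner_Basis if_distrib cong: if_cong)
  finally have "tensor_laplacian (gas_tensor \<rho> u p) v x = \<rho> x * H (u x) (u x) + p x * (\<Sum>b\<in>Basis. H b b)" .
  moreover have "has_second_dir_deriv v x h (H h h)" for h
    unfolding H_def by (rule has_second_dir_deriv_smooth[OF v])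
  ultimately show ?thesis
    unfolding has_gas_operator_at_def by (rule_tac x = "\<lambda>h. H h h" in exI) simp
qed

section \<open>Hyperbolicity when the flow is nearly tangential\<close>

lemma Ck_add:
  assumes "Ck k f" "Ck k g" shows "Ck k (\<lambda>x. f x + g x)"
  using assms
proof (induction k arbitrary: f g)
  case 0
  then show ?case by (auto intro: continuous_on_add)
next
  case (Suc k)
  have D: "frechet_derivative (\<lambda>x. f x + g x) (at x)
      = (\<lambda>h. frechet_derivative f (at x) h + frechet_derivative g (at x) h)" for x
    by (rule frechet_derivative_at[symmetric], rule has_derivative_add)
      (use Suc.prems in \<open>simp_all add: frechet_derivative_works\<close>)
  show ?case using Suc.prems Suc.IH unfolding Ck.simps(2)[of k] D by simp
qed

lemma Ck_mult:
  fixes f g :: "'a::real_normed_vector \<Rightarrow> real"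
  assumes "Ck k f" "Ck k g" shows "Ck k (\<lambda>x. f x * g x)"
  using assms
proof (induction k arbitrary: f g)
  case 0
  then show ?case by (auto intro: continuous_on_mult)
next
  case (Suc k)
  have D: "frechet_derivative (\<lambda>x. f x * g x) (at x)
      = (\<lambda>h. f x * frechet_derivative g (at x) h + frechet_derivative f (at x) h * g x)" for x
    by (rule frechet_derivative_at[symmetric], rule has_derivative_mult)
      (use Suc.prems in \<open>simp_all add: frechet_derivative_works\<close>)
  have "Ck k (\<lambda>x. f x * frechet_derivative g (at x) h + frechet_derivative f (at x) h * g x)" for h
    by (intro Ck_add Suc.IH) (use Suc.prems Ck_SucD in \<open>simp_all\<close>)
  then show ?case using Suc.prems unfolding Ck.simps(2)[of k] D by simp
qed

lemma Ck_const: "Ck k (\<lambda>x. c)"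
  by (induction k arbitrary: c) simp_all

lemma Ck_inner_const: "Ck k (\<lambda>x. x \<bullet> h)"
proof (cases k)
  case 0
  then show ?thesis by (auto intro: continuous_intros)
next
  case (Suc j)
  have d: "((\<lambda>x. x \<bullet> h) has_derivative (\<lambda>k. k \<bullet> h)) (at x)" for x :: 'a
    by (rule has_derivative_inner_left[OF has_derivative_ident])
  then have "(\<lambda>x. x \<bullet> h) differentiable (at x)" for x :: 'a
    by (rule differentiableI)
  then show ?thesis unfolding Suc Ck.simps frechet_derivative_at[OF d, symmetric]
    by (simp add: Ck_const)
qed

text \<open>This function tends to \<open>0\<close> at infinity like \<open>- 1 / |x|\<close>, the Newtonian potential of \<open>\<real>\<^sup>3\<close>; the
  summand \<open>1\<close> makes it smooth at the origin.\<close>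

definition potential :: "'a::real_inner \<Rightarrow> real" where
  "potential x = - ((1 + (norm x)\<^sup>2) powr (-1/2))"

text \<open>The derivative is written in terms of the function itself, which makes smoothness an induction:
  if the function is \<open>C\<^sup>k\<close>, then so is this product, hence the function is \<open>C\<^sup>k\<^sup>+\<^sup>1\<close>.\<close>

lemma has_derivative_potential:
  "(potential has_derivative (\<lambda>h. - (potential x * (potential x * (potential x * (x \<bullet> h)))))) (at x)"
proof -
  have pos: "1 + (norm x)\<^sup>2 > 0" by (simp add: add_pos_nonneg)
  have d: "DERIV (\<lambda>s. - ((1 + s) powr (-1/2))) ((norm x)\<^sup>2) :> (1/2) * (1 + (norm x)\<^sup>2) powr (-3/2)"
    using pos by (auto intro!: derivative_eq_intros)
  have "((\<lambda>x. x \<bullet> x) has_derivative (\<lambda>h. x \<bullet> h + h \<bullet> x)) (at x)"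
    by (rule has_derivative_inner[OF has_derivative_ident has_derivative_ident])
  then have n: "((\<lambda>x. (norm x)\<^sup>2) has_derivative (\<lambda>h. 2 * (x \<bullet> h))) (at x)"
    by (simp add: power2_norm_eq_inner inner_commute)
  have "(1 + (norm x)\<^sup>2) powr (-3/2)
      = (1 + (norm x)\<^sup>2) powr (-1/2) * ((1 + (norm x)\<^sup>2) powr (-1/2) * (1 + (norm x)\<^sup>2) powr (-1/2))"
    unfolding powr_add[symmetric] by simp
  then have eq: "(\<lambda>h. (1/2) * (1 + (norm x)\<^sup>2) powr (-3/2) * (2 * (x \<bullet> h)))
      = (\<lambda>h. - (potential x * (potential x * (potential x * (x \<bullet> h)))))"
    by (simp add: potential_def)
  show ?thesis
    using has_derivative_compose[OF n d[unfolded has_field_derivative_def]]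
    unfolding eq potential_def[symmetric] potential_def[abs_def, symmetric] .
qed

lemma smooth_potential: "smooth (potential :: 'a::real_inner \<Rightarrow> real)"
proof -
  have "Ck k (potential :: 'a \<Rightarrow> real)" for k
  proof (induction k)
    case 0
    show ?case
      by (simp add: continuous_at_imp_continuous_on has_derivative_continuous[OF has_derivative_potential])
  next
    case (Suc k)
    have "Ck k (\<lambda>x. (-1) * (potential x * (potential x * (potential x * (x \<bullet> h)))))" for h :: 'a
      by (rule Ck_mult[OF Ck_const], rule Ck_mult[OF Suc], rule Ck_mult[OF Suc],
          rule Ck_mult[OF Suc], rule Ck_inner_const)
    moreover have "potential differentiable (at x)" for x :: 'a
      by (rule differentiableI[OF has_derivative_potential])
    ultimately show ?case
      by (simp add: frechet_derivative_at[OF has_derivative_potential, symmetric])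
  qed
  then show ?thesis by (simp add: smooth_def)
qed

text \<open>With \<open>q = |x|\<^sup>2\<close> and \<open>\<phi> s = - (1 + s)\<^sup>-\<^sup>1\<^sup>/\<^sup>2\<close>, the value of the operator is
  \<open>K (r ((1 + q)|U|\<^sup>2 - 3 \<langle>x,U\<rangle>\<^sup>2) + P ((1 + q) n - 3 q))\<close> for \<open>K = (1 + q)\<^sup>-\<^sup>5\<^sup>/\<^sup>2\<close>: the angle condition makes the
  first bracket nonnegative, \<open>n \<ge> 3\<close> the second.\<close>

lemma potential_subsolution:
  fixes x U :: "'a::euclidean_space" and r P :: real
  assumes "DIM('a) \<ge> 3" "r \<ge> 0" "P \<ge> 0" and angle: "3 * (x \<bullet> U)\<^sup>2 \<le> (norm x)\<^sup>2 * (norm U)\<^sup>2"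
  shows "\<exists>l\<ge>0. has_gas_operator_at r U P potential x l"
proof -
  define q where "q = (norm x)\<^sup>2"
  define K where "K = (1 + q) powr (-5/2)"
  have q: "q \<ge> 0" by (simp add: q_def)
  have K3: "(1 + q) powr (-3/2) = (1 + q) * K"
    using powr_add[of "1 + q" 1 "-5/2"] q by (simp add: K_def)
  have op: "has_gas_operator_at r U P (\<lambda>x. - ((1 + (norm (x - 0))\<^sup>2) powr (-1/2))) x
    (4 * (-3/4 * K) * (r * ((x - 0) \<bullet> U)\<^sup>2 + P * (norm (x - 0))\<^sup>2)
      + 2 * ((1/2) * (1 + (norm (x - 0))\<^sup>2) powr (-3/2)) * (r * (norm U)\<^sup>2 + P * DIM('a)))"
  proof (rule has_gas_operator_at_radial[where S = "{-1<..}"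
        and \<phi> = "\<lambda>s. - ((1 + s) powr (-1/2))" and \<phi>' = "\<lambda>s. (1/2) * (1 + s) powr (-3/2)"])
    have "-1 < q" using q by linarith
    then show "(norm (x - 0))\<^sup>2 \<in> {-1<..}" by (simp only: q_def diff_zero greaterThan_iff)
    show "DERIV (\<lambda>s. - ((1 + s) powr (-1/2))) s :> (1/2) * (1 + s) powr (-3/2)" if "s \<in> {-1<..}" for s :: real
      using that by (auto intro!: derivative_eq_intros)
    have "1 + q > 0" using q by simp
    then show "DERIV (\<lambda>s. (1/2) * (1 + s) powr (-3/2)) ((norm (x - 0))\<^sup>2) :> -3/4 * K"
      by (auto intro!: derivative_eq_intros simp: K_def q_def)
  qed simp
  define l where "l = K * (r * ((1 + q) * (norm U)\<^sup>2 - 3 * (x \<bullet> U)\<^sup>2) + P * ((1 + q) * DIM('a) - 3 * q))"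
  have "3 * (x \<bullet> U)\<^sup>2 \<le> (1 + q) * (norm U)\<^sup>2"
    using angle by (simp add: q_def algebra_simps add_increasing)
  moreover have "3 * q \<le> (1 + q) * DIM('a)"
  proof -
    have "3 * q \<le> DIM('a) * q" using assms(1) q by (intro mult_right_mono) auto
    then show ?thesis by (simp add: algebra_simps)
  qed
  ultimately have "l \<ge> 0" unfolding l_def K_def using assms(2,3) by (intro mult_nonneg_nonneg add_nonneg_nonneg) auto
  moreover have "4 * (-3/4 * K) * (r * (x \<bullet> U)\<^sup>2 + P * q)
      + 2 * ((1/2) * ((1 + q) * K)) * (r * (norm U)\<^sup>2 + P * DIM('a)) = l"
    by (simp add: l_def field_simps)
  then have "has_gas_operator_at r U P potential x l"
    using op unfolding potential_def[abs_def] diff_zero q_def[symmetric] K3 by (simp only:)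
  ultimately show ?thesis by blast
qed

lemma hyperbolic_gas_tensor:
  fixes u :: "'a::euclidean_space \<Rightarrow> 'a"
  assumes s: "smooth \<rho>" "smooth u" "smooth p" "steady_euler \<rho> u p"
    and nonneg: "\<And>x. \<rho> x \<ge> 0" "\<And>x. p x \<ge> 0" and "DIM('a) \<ge> 3"
    and angle: "\<And>x. 3 * (x \<bullet> u x)\<^sup>2 \<le> (norm x)\<^sup>2 * (norm (u x))\<^sup>2"
  shows "hyperbolic (gas_tensor \<rho> u p)"
proof -
  have "tensor_laplacian (gas_tensor \<rho> u p) potential x \<ge> 0" for x
    using potential_subsolution[OF assms(7) nonneg(1) nonneg(2) angle, of x]
      has_gas_operator_at_tensor_laplacian[OF s smooth_potential, of x] has_gas_operator_at_unique
    by blast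
  moreover have "bdd_above (range (potential :: 'a \<Rightarrow> real))"
    by (rule bdd_aboveI[of _ 0]) (auto simp: potential_def)
  moreover have "\<not> (potential :: 'a \<Rightarrow> real) constant_on UNIV"
  proof
    obtain b :: 'a where b: "b \<in> Basis" using nonempty_Basis by blast
    assume "(potential :: 'a \<Rightarrow> real) constant_on UNIV"
    then have "potential b = potential (0 :: 'a)" by (auto simp: constant_on_def)
    then show False using b by (simp add: potential_def)
  qed
  ultimately show ?thesis
    unfolding hyperbolic_def parabolic_def using smooth_potential by blast
qed

section \<open>The strong maximum principle\<close>

text \<open>In the radial formula for \<open>\<phi> s = exp (- \<alpha> s)\<close> the term with \<open>\<phi>''\<close> carries \<open>\<alpha>\<^sup>2\<close>, the one with \<open>\<phi>'\<close>
  only \<open>\<alpha>\<close>. Away from the centre \<open>y\<close> the first dominates for large \<open>\<alpha>\<close>, because \<open>P > 0\<close>.\<close>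

lemma gas_operator_exp_barrier:
  fixes y z U :: "'a::euclidean_space" and r P :: real
  assumes "\<alpha> > 0" "r \<ge> 0" "P > 0" "r * (norm U)\<^sup>2 + P * DIM('a) < 2 * \<alpha> * (P * (norm (z - y))\<^sup>2)"
  shows "\<exists>l>0. has_gas_operator_at r U P (\<lambda>x. exp (- \<alpha> * (norm (x - y))\<^sup>2)) z l"
proof -
  define E where "E = exp (- \<alpha> * (norm (z - y))\<^sup>2)"
  define l where "l = 4 * (\<alpha>\<^sup>2 * E) * (r * ((z - y) \<bullet> U)\<^sup>2 + P * (norm (z - y))\<^sup>2)
      + 2 * (- \<alpha> * E) * (r * (norm U)\<^sup>2 + P * DIM('a))"
  have op: "has_gas_operator_at r U P (\<lambda>x. exp (- \<alpha> * (norm (x - y))\<^sup>2)) z l"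
    unfolding l_def E_def
    by (rule has_gas_operator_at_radial[where S = UNIV and \<phi> = "\<lambda>s. exp (- \<alpha> * s)" and \<phi>' = "\<lambda>s. - \<alpha> * exp (- \<alpha> * s)"])
      (auto intro!: derivative_eq_intros simp: power2_eq_square)
  have "l = 2 * \<alpha> * E * (2 * \<alpha> * (r * ((z - y) \<bullet> U)\<^sup>2) +
     (2 * \<alpha> * (P * (norm (z - y))\<^sup>2) - (r * (norm U)\<^sup>2 + P * DIM('a))))"
    by (simp add: l_def power2_eq_square algebra_simps)
  moreover have "\<dots> > 0"
    using assms by (intro mult_pos_pos add_nonneg_pos) (auto simp: E_def)
  ultimately have "l > 0" by (simp only:)
  with op show ?thesis by blast
qed

text \<open>Take a point \<open>y0\<close> outside \<open>F\<close>, a point \<open>x0\<close> of \<open>F\<close> nearest to it, and the ball with diameter from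
  \<open>y0\<close> to \<open>x0\<close>. It lies in the ball around \<open>y0\<close> through \<open>x0\<close> and meets the sphere of the latter in \<open>x0\<close>
  alone, by the equality case of the triangle inequality.\<close>

lemma interior_tangent_ball:
  fixes F :: "'a::euclidean_space set"
  assumes "closed F" "F \<noteq> {}" "F \<noteq> UNIV"
  obtains x0 y R where "R > 0" "x0 \<in> F" "dist x0 y = R" "\<And>x. x \<in> cball y R \<Longrightarrow> x \<noteq> x0 \<Longrightarrow> x \<notin> F"
proof -
  obtain y0 where y0: "y0 \<notin> F" using assms(3) by blast
  obtain x0 where x0: "x0 \<in> F" "\<And>x. x \<in> F \<Longrightarrow> dist y0 x0 \<le> dist y0 x"
    using distance_attains_inf[OF assms(1,2), of y0] by blast
  define y where "y = y0 + (1/2) *\<^sub>R (x0 - y0)"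
  define R where "R = norm (x0 - y0) / 2"
  have R: "R > 0" using y0 x0(1) by (auto simp: R_def)
  have y: "y - y0 = (1/2) *\<^sub>R (x0 - y0)" "x0 - y = (1/2) *\<^sub>R (x0 - y0)"
    by (simp_all add: y_def algebra_simps flip: scaleR_add_left)
  then have nR: "norm (y - y0) = R" "norm (x0 - y) = R" by (simp_all add: R_def)
  have "x \<notin> F" if "x \<in> cball y R" "x \<noteq> x0" for x
  proof
    assume "x \<in> F"
    then have "2 * R \<le> norm ((x - y) + (y - y0))"
      using x0(2) by (simp add: dist_norm norm_minus_commute R_def)
    moreover have le: "norm (x - y) \<le> R" using that(1) by (simp add: dist_norm norm_minus_commute)
    ultimately have "norm ((x - y) + (y - y0)) = norm (x - y) + norm (y - y0)" and xR: "norm (x - y) = R"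
      using norm_triangle_ineq[of "x - y" "y - y0"] nR by linarith+
    then have "R *\<^sub>R (y - y0) = R *\<^sub>R (x - y)"
      using norm_triangle_eq[of "x - y" "y - y0"] nR by metis
    then have "y - y0 = x - y" using R by simp
    then have "x - y = x0 - y" using y by simp
    then show False using that(2) by simp
  qed
  then show thesis using that[OF R x0(1), of y] nR(2) by (simp add: dist_norm)
qed

text \<open>Hopf's argument. If the set \<open>F\<close> of maximum points is not everything, a ball \<open>cball y R\<close> touches it in
  one point \<open>x0\<close> only. On a small sphere around \<open>x0\<close>, the barrier \<open>h = exp (- \<alpha> |x - y|\<^sup>2)\<close> is below
  its value at \<open>x0\<close> outside \<open>cball y R\<close>, and \<open>v\<close> is below its maximum by a fixed amount inside.
  So \<open>v + \<epsilon> h\<close> has an interior maximum in the ball around \<open>x0\<close>, where the operator would have to be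
  both positive and at most \<open>0\<close>.\<close>

lemma strong_maximum_principle:
  fixes \<rho> p v :: "'a::euclidean_space \<Rightarrow> real" and u :: "'a \<Rightarrow> 'a"
  assumes cont: "continuous_on UNIV \<rho>" "continuous_on UNIV u" "continuous_on UNIV p" "continuous_on UNIV v"
    and pos: "\<And>x. \<rho> x \<ge> 0" "\<And>x. p x > 0"
    and sub: "\<And>x. has_gas_operator_at (\<rho> x) (u x) (p x) v x (l x)" "\<And>x. l x \<ge> 0"
    and max: "\<And>x. v x \<le> v a"
  shows "v x = v a"
proof (rule ccontr)
  assume "v x \<noteq> v a"
  define F where "F = {x. v x = v a}"
  have "closed F" unfolding F_def
    by (rule closed_Collect_eq) (use cont(4) in auto)
  moreover have "F \<noteq> {}" "F \<noteq> UNIV" using \<open>v x \<noteq> v a\<close> by (auto simp: F_def)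
  ultimately obtain x0 y R where R: "R > 0" and x0: "x0 \<in> F" "dist x0 y = R"
    and out: "\<And>x. x \<in> cball y R \<Longrightarrow> x \<noteq> x0 \<Longrightarrow> x \<notin> F"
    by (rule interior_tangent_ball) metis
  define B where "B = cball x0 (R/2)"
  have far: "norm (z - y) \<ge> R/2" if "z \<in> B" for z
    using that x0(2) dist_triangle[of x0 y z] by (simp add: B_def dist_norm)
  \<comment> \<open>The barrier requires \<open>Q < 2 \<alpha> |z - y|\<^sup>2\<close>, where \<open>|z - y| \<ge> R/2\<close>; a bound of \<open>Q\<close> on the compact \<open>B\<close>
    yields one \<open>\<alpha>\<close> for all of \<open>B\<close>.\<close>
  define Q where "Q z = (\<rho> z * (norm (u z))\<^sup>2 + p z * DIM('a)) / p z" for z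
  have nz: "p z \<noteq> 0" for z using pos(2)[of z] by simp
  have "continuous_on B Q" unfolding Q_def
    by (intro continuous_intros continuous_on_subset[OF cont(1)] continuous_on_subset[OF cont(2)]
        continuous_on_subset[OF cont(3)]) (auto simp: nz)
  moreover have "compact B" "x0 \<in> B" using R by (auto simp: B_def)
  ultimately obtain zC where zC: "zC \<in> B" "\<And>z. z \<in> B \<Longrightarrow> Q z \<le> Q zC"
    using continuous_attains_sup[of B Q] by blast
  define \<alpha> where "\<alpha> = 2 * (Q zC + 1) / R\<^sup>2"
  have "Q zC \<ge> 0" unfolding Q_def using pos[of zC] by (intro divide_nonneg_pos add_nonneg_nonneg) auto
  then have \<alpha>: "\<alpha> > 0" using R by (simp add: \<alpha>_def)
  define h where "h z = exp (- \<alpha> * (norm (z - y))\<^sup>2)" for z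
  have barrier: "\<exists>m>0. has_gas_operator_at (\<rho> z) (u z) (p z) h z m" if "z \<in> B" for z
    unfolding h_def
  proof (rule gas_operator_exp_barrier[OF \<alpha> pos])
    have "\<rho> z * (norm (u z))\<^sup>2 + p z * DIM('a) = p z * Q z" by (simp add: Q_def nz)
    also have "\<dots> < p z * (Q zC + 1)"
      using zC(2)[OF that] pos(2)[of z] by (intro mult_strict_left_mono) auto
    also have "\<dots> = 2 * \<alpha> * (p z * (R / 2)\<^sup>2)"
      using R by (simp add: \<alpha>_def power_divide field_simps)
    also have "\<dots> \<le> 2 * \<alpha> * (p z * (norm (z - y))\<^sup>2)"
      using \<alpha> R pos(2)[of z] power_mono[OF far[OF that], of 2] by (intro mult_left_mono) auto
    finally show "\<rho> z * (norm (u z))\<^sup>2 + p z * DIM('a) < 2 * \<alpha> * (p z * (norm (z - y))\<^sup>2)" .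
  qed
  define T where "T = sphere x0 (R/2) \<inter> cball y R"
  have vT: "v z < v a" if "z \<in> T" for z
    using out[of z] that R max[of z] by (auto simp: T_def F_def)
  have "\<exists>m < v a. \<forall>z\<in>T. v z \<le> m"
  proof (cases "T = {}")
    case True
    then show ?thesis by (auto intro: exI[of _ "v a - 1"])
  next
    case False
    have "compact T" unfolding T_def by (intro compact_Int_closed) auto
    then obtain t where "t \<in> T" "\<And>z. z \<in> T \<Longrightarrow> v z \<le> v t"
      using continuous_attains_sup[OF _ False continuous_on_subset[OF cont(4)]] by blast
    then show ?thesis using vT by blast
  qed
  then obtain m where m: "m < v a" "\<And>z. z \<in> T \<Longrightarrow> v z \<le> m" by blast
  \<comment> \<open>As \<open>h \<le> 1\<close>, the barrier cannot make up for the gap \<open>v a - m\<close> on \<open>T\<close>.\<close>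
  define \<epsilon> where "\<epsilon> = v a - m"
  have \<epsilon>: "\<epsilon> > 0" using m(1) by (simp add: \<epsilon>_def)
  define w where "w z = v z + \<epsilon> * h z" for z
  have wx0: "w x0 = v a + \<epsilon> * exp (- \<alpha> * R\<^sup>2)"
    using x0 by (simp add: w_def F_def h_def dist_norm)
  have wS: "w z < w x0" if "z \<in> sphere x0 (R/2)" for z
  proof (cases "z \<in> cball y R")
    case True
    then have "v z \<le> m" using m(2) that by (simp add: T_def)
    moreover have "\<epsilon> * h z \<le> \<epsilon> * 1" using \<epsilon> \<alpha> by (intro mult_left_mono) (auto simp: h_def)
    ultimately have "w z \<le> v a" by (simp add: w_def \<epsilon>_def)
    moreover have "\<epsilon> * exp (- \<alpha> * R\<^sup>2) > 0" using \<epsilon> by simp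
    ultimately show ?thesis unfolding wx0 by linarith
  next
    case False
    then have "R < norm (z - y)" by (simp add: dist_norm norm_minus_commute)
    then have "R\<^sup>2 < (norm (z - y))\<^sup>2" using R by (intro power_strict_mono) auto
    then have "h z < exp (- \<alpha> * R\<^sup>2)" using \<alpha> by (simp add: h_def)
    then have "\<epsilon> * h z < \<epsilon> * exp (- \<alpha> * R\<^sup>2)" using \<epsilon> by simp
    then have "w z < v a + \<epsilon> * exp (- \<alpha> * R\<^sup>2)" unfolding w_def using max[of z] by linarith
    then show ?thesis unfolding wx0 .
  qed
  have "continuous_on B w" unfolding w_def h_def
    by (intro continuous_intros continuous_on_subset[OF cont(4)]) auto
  then obtain z where z: "z \<in> B" "\<And>x. x \<in> B \<Longrightarrow> w x \<le> w z"
    using continuous_attains_sup[OF \<open>compact B\<close>, of w] \<open>x0 \<in> B\<close> by blast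
  have "z \<notin> sphere x0 (R/2)" using wS[of z] z(2)[OF \<open>x0 \<in> B\<close>] by auto
  then have "z \<in> ball x0 (R/2)" using z(1) by (auto simp: B_def)
  then have loc: "\<forall>\<^sub>F x in nhds z. w x \<le> w z"
    by (rule eventually_mono[OF eventually_nhds_in_open[OF open_ball]]) (use z(2) in \<open>simp add: B_def\<close>)
  obtain k where k: "k > 0" "has_gas_operator_at (\<rho> z) (u z) (p z) h z k" using barrier[OF z(1)] by blast
  have "has_gas_operator_at (\<rho> z) (u z) (p z) w z (l z + \<epsilon> * k)"
    unfolding w_def by (rule has_gas_operator_at_add_cmult[OF sub(1) k(2)])
  from gas_operator_local_max_le_0[OF this pos(1) less_imp_le[OF pos(2)] loc]
  show False using sub(2)[of z] mult_pos_pos[OF \<epsilon> k(1)] by linarith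
qed

section \<open>Parabolicity in the plane when the flow is nearly radial\<close>

text \<open>For \<open>\<phi> s = ln (ln s)\<close> one has \<open>\<phi>'' \<le> 0\<close>, so the angle condition bounds the radial formula by
  \<open>2 (r |U|\<^sup>2 + 2 P) (q \<phi>'' + \<phi>')\<close> with \<open>q = |z|\<^sup>2\<close>. Here \<open>q \<phi>'' + \<phi>' = (q \<phi>')'\<close> and \<open>q \<phi>' = 1 / ln q\<close> is
  strictly decreasing. (For \<open>\<phi> = ln\<close> this expression is \<open>0\<close>; the second logarithm makes
  the supersolution strict, as the second derivative test demands.)\<close>

lemma ln_ln_strict_supersolution:
  fixes z U :: "'a::euclidean_space" and r P :: real
  assumes "DIM('a) = 2" "r \<ge> 0" "P > 0" "norm z > 1"
    and angle: "2 * (z \<bullet> U)\<^sup>2 \<ge> (norm z)\<^sup>2 * (norm U)\<^sup>2"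
  shows "\<exists>l<0. has_gas_operator_at r U P (\<lambda>x. ln (ln ((norm x)\<^sup>2))) z l"
proof -
  define q where "q = (norm z)\<^sup>2"
  have q: "q > 1" using assms(4) by (simp add: q_def one_less_power)
  define k where "k = - (ln q + 1) / (q * ln q)\<^sup>2"
  have op: "has_gas_operator_at r U P (\<lambda>x. ln (ln ((norm (x - 0))\<^sup>2))) z
    (4 * k * (r * ((z - 0) \<bullet> U)\<^sup>2 + P * (norm (z - 0))\<^sup>2)
      + 2 * (1 / ((norm (z - 0))\<^sup>2 * ln ((norm (z - 0))\<^sup>2))) * (r * (norm U)\<^sup>2 + P * DIM('a)))"
  proof (rule has_gas_operator_at_radial[where S = "{1<..}" and \<phi> = "\<lambda>s. ln (ln s)" and \<phi>' = "\<lambda>s. 1 / (s * ln s)"])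
    show "(norm (z - 0))\<^sup>2 \<in> {1<..}" using q by (simp add: q_def)
    show "DERIV (\<lambda>s. ln (ln s)) s :> 1 / (s * ln s)" if "s \<in> {1<..}" for s :: real
      using that by (auto intro!: derivative_eq_intros simp: field_simps)
    have "DERIV (\<lambda>s. 1 / (s * ln s)) q :> k"
      using q unfolding k_def by (auto intro!: derivative_eq_intros simp: field_simps power2_eq_square)
    then show "DERIV (\<lambda>s. 1 / (s * ln s)) ((norm (z - 0))\<^sup>2) :> k" by (simp add: q_def)
  qed simp
  define l where "l = 4 * k * (r * (z \<bullet> U)\<^sup>2 + P * q) + 2 * (1 / (q * ln q)) * (r * (norm U)\<^sup>2 + P * 2)"
  have lnq: "ln q > 0" using q by simp
  then have "- (ln q + 1) \<le> 0" by linarith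
  then have "k \<le> 0" unfolding k_def by (rule divide_nonpos_nonneg) simp
  then have "4 * k * (r * (z \<bullet> U)\<^sup>2 + P * q) \<le> 4 * k * (r * (q * (norm U)\<^sup>2 / 2) + P * q)"
    using angle assms(2) by (intro mult_left_mono_neg add_right_mono mult_left_mono) (auto simp: q_def)
  then have "l \<le> 4 * k * (r * (q * (norm U)\<^sup>2 / 2) + P * q) + 2 * (1 / (q * ln q)) * (r * (norm U)\<^sup>2 + P * 2)"
    by (simp add: l_def)
  also have "\<dots> = (2 * (r * (norm U)\<^sup>2 + P * 2)) * (q * k + 1 / (q * ln q))"
    by (simp add: algebra_simps)
  also have "q * k + 1 / (q * ln q) = - 1 / (q * (ln q)\<^sup>2)"
    using q lnq by (simp add: k_def field_simps power2_eq_square)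
  also have "2 * (r * (norm U)\<^sup>2 + P * 2) * (- 1 / (q * (ln q)\<^sup>2)) < 0"
    using q lnq assms(2,3) by (intro mult_pos_neg divide_neg_pos mult_pos_pos add_nonneg_pos) auto
  finally have "l < 0" .
  then show ?thesis using op assms(1) by (auto simp: l_def q_def)
qed

text \<open>Let \<open>a\<close> be a maximum point of \<open>v\<close> on the disc of radius \<open>e\<close>, and suppose that \<open>v x1 > v a\<close>. For small
  \<open>\<epsilon>\<close> the function \<open>w = v - \<epsilon> ln (ln |x|\<^sup>2)\<close> still exceeds \<open>v a\<close> at \<open>x1\<close>, but not on the circle
  of radius \<open>e\<close> nor, as \<open>v\<close> is bounded above, on a large circle. So \<open>w\<close> has a maximum inside the annulus,
  which contradicts the strict positivity of the operator on \<open>w\<close>.\<close>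

lemma bounded_subsolution_attains_max:
  fixes \<rho> p v :: "'a::euclidean_space \<Rightarrow> real" and u :: "'a \<Rightarrow> 'a"
  assumes "DIM('a) = 2" "continuous_on UNIV v" "bdd_above (range v)"
    and pos: "\<And>x. \<rho> x \<ge> 0" "\<And>x. p x > 0"
    and angle: "\<And>x. 2 * (x \<bullet> u x)\<^sup>2 \<ge> (norm x)\<^sup>2 * (norm (u x))\<^sup>2"
    and sub: "\<And>x. has_gas_operator_at (\<rho> x) (u x) (p x) v x (l x)" "\<And>x. l x \<ge> 0"
  obtains a where "\<And>x. v x \<le> v a"
proof -
  \<comment> \<open>For \<open>|x| \<ge> exp 1\<close> one has \<open>ln |x|\<^sup>2 \<ge> 2\<close>, so the second logarithm is positive.\<close>
  define e :: real where "e = exp 1"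
  have e1: "e > 1" by (simp add: e_def)
  have "compact (cball 0 e :: 'a set)" "(cball 0 e :: 'a set) \<noteq> {}" using e1 by auto
  then obtain a where "\<forall>x\<in>cball 0 e. v x \<le> v a"
    using continuous_attains_sup[OF _ _ continuous_on_subset[OF assms(2) subset_UNIV]] by metis
  then have a: "v x \<le> v a" if "norm x \<le> e" for x using that by simp
  have "v x1 \<le> v a" for x1
  proof (rule ccontr)
    assume gt: "\<not> v x1 \<le> v a"
    then have x1: "norm x1 > e" using a[of x1] by linarith
    obtain C where C: "\<And>x. v x \<le> C" using assms(3) by (auto simp: bdd_above_def)
    define \<psi> :: "'a \<Rightarrow> real" where "\<psi> x = ln (ln ((norm x)\<^sup>2))" for x
    have ln2: "ln ((norm x)\<^sup>2) \<ge> 2" if "norm x \<ge> e" for x :: 'a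
    proof -
      have "0 < norm x" using that e1 by linarith
      then have "ln (norm x) \<ge> ln e" using that e1 by (subst ln_le_cancel_iff) auto
      then show ?thesis using \<open>0 < norm x\<close> by (simp add: ln_realpow e_def)
    qed
    have \<psi>0: "\<psi> x > 0" if "norm x \<ge> e" for x
      using ln2[OF that] by (simp add: \<psi>_def)
    \<comment> \<open>This choice makes \<open>w x1\<close> the mean of \<open>v x1\<close> and \<open>v a\<close>.\<close>
    define \<epsilon> where "\<epsilon> = (v x1 - v a) / (2 * \<psi> x1)"
    have \<psi>1: "\<psi> x1 > 0" using \<psi>0 x1 by simp
    have \<epsilon>: "\<epsilon> > 0" using gt \<psi>1 by (simp add: \<epsilon>_def)
    \<comment> \<open>\<open>T\<close> is the value of \<open>\<psi>\<close> on the circle of radius \<open>R\<close>: large enough to enclose \<open>x1\<close>, and for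
      \<open>C - \<epsilon> T \<le> v a\<close>.\<close>
    define T where "T = max (\<psi> x1) ((C - v a) / \<epsilon>)"
    define R where "R = exp (exp T / 2)"
    have R2: "ln (R\<^sup>2) = exp T" by (simp add: R_def ln_realpow)
    have "ln ((norm x1)\<^sup>2) \<le> exp T"
      using ln2[of x1] x1 by (simp add: T_def \<psi>_def ln_ge_iff[symmetric] flip: ln_le_cancel_iff)
    then have "ln (norm x1) \<le> ln R" using x1 e1 by (simp add: ln_realpow R_def)
    then have x1R: "norm x1 \<le> R" using x1 e1 by (subst (asm) ln_le_cancel_iff) (auto simp: R_def)
    define K :: "'a set" where "K = cball 0 R - ball 0 e"
    have K: "compact K" "x1 \<in> K" using x1 x1R by (auto simp: K_def compact_diff)
    define w where "w x = v x + (- \<epsilon>) * \<psi> x" for x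
    have "continuous_on K w" unfolding w_def \<psi>_def
    proof (intro continuous_intros continuous_on_subset[OF assms(2)])
      show "\<forall>x\<in>K. ln ((norm x)\<^sup>2) \<noteq> 0"
      proof
        fix x assume "x \<in> K"
        then have "e \<le> norm x" by (simp add: K_def)
        then show "ln ((norm x)\<^sup>2) \<noteq> 0" using ln2[of x] by linarith
      qed
      show "\<forall>x\<in>K. (norm x)\<^sup>2 \<noteq> 0" using e1 by (auto simp: K_def)
    qed auto
    then obtain z where z: "z \<in> K" "\<And>x. x \<in> K \<Longrightarrow> w x \<le> w z"
      using continuous_attains_sup[OF K(1), of w] K(2) by blast
    have "w x1 = (v x1 + v a) / 2" using \<psi>1 by (simp add: w_def \<epsilon>_def field_simps)
    also have "\<dots> > v a" using gt by simp
    finally have wz: "w z > v a" using z(2)[OF K(2)] by (rule less_le_trans)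
    have ze: "norm z > e"
    proof (rule ccontr)
      assume "\<not> norm z > e"
      then have "norm z = e" using z(1) by (auto simp: K_def)
      then have "w z \<le> v a" using a[of z] mult_pos_pos[OF \<epsilon> \<psi>0[of z]] by (simp add: w_def)
      then show False using wz by simp
    qed
    have zR: "norm z < R"
    proof (rule ccontr)
      assume "\<not> norm z < R"
      then have "norm z = R" using z(1) by (auto simp: K_def)
      then have "\<psi> z = T" by (simp add: \<psi>_def R2)
      moreover have "\<epsilon> * T \<ge> \<epsilon> * ((C - v a) / \<epsilon>)" using \<epsilon> by (intro mult_left_mono) (auto simp: T_def)
      ultimately have "w z \<le> v a" using C[of z] \<epsilon> by (simp add: w_def)
      then show False using wz by simp
    qed
    have "open (ball 0 R - cball 0 e :: 'a set)" "z \<in> ball 0 R - cball 0 e"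
      using ze zR by auto
    then have loc: "\<forall>\<^sub>F x in nhds z. w x \<le> w z"
      by (rule eventually_mono[OF eventually_nhds_in_open]) (use z(2) in \<open>auto simp: K_def\<close>)
    obtain k where k: "k < 0" "has_gas_operator_at (\<rho> z) (u z) (p z) \<psi> z k"
      using ln_ln_strict_supersolution[OF assms(1) pos(1,2) _ angle, of z] ze e1 unfolding \<psi>_def by force
    have "has_gas_operator_at (\<rho> z) (u z) (p z) w z (l z + (- \<epsilon>) * k)"
      unfolding w_def by (rule has_gas_operator_at_add_cmult[OF sub(1) k(2)])
    from gas_operator_local_max_le_0[OF this pos(1) less_imp_le[OF pos(2)] loc]
    show False using sub(2)[of z] mult_pos_neg[OF \<epsilon> k(1)] by linarith
  qed
  then show thesis by (rule that)
qed

lemma parabolic_gas_tensor: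
  fixes u :: "'a::euclidean_space \<Rightarrow> 'a"
  assumes s: "smooth \<rho>" "smooth u" "smooth p" "steady_euler \<rho> u p"
    and pos: "\<And>x. \<rho> x \<ge> 0" "\<And>x. p x > 0" and dim: "DIM('a) = 2"
    and angle: "\<And>x. 2 * (x \<bullet> u x)\<^sup>2 \<ge> (norm x)\<^sup>2 * (norm (u x))\<^sup>2"
  shows "parabolic (gas_tensor \<rho> u p)"
  unfolding parabolic_def
proof (intro allI impI, elim conjE)
  fix v :: "'a \<Rightarrow> real"
  assume v: "smooth v" "bdd_above (range v)" "\<forall>x. 0 \<le> tensor_laplacian (gas_tensor \<rho> u p) v x"
  have c: "smooth f \<Longrightarrow> continuous_on UNIV f" for f :: "'a \<Rightarrow> 'b::real_normed_vector"
    unfolding smooth_def using Ck.simps(1) by metis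
  note op = has_gas_operator_at_tensor_laplacian[OF s v(1)]
  obtain a where "\<And>x. v x \<le> v a"
    using bounded_subsolution_attains_max[OF dim c[OF v(1)] v(2) pos angle op] v(3) by blast
  then have "v x = v a" for x
    using strong_maximum_principle[OF c[OF s(1)] c[OF s(2)] c[OF s(3)] c[OF v(1)] pos op] v(3) by blast
  then show "v constant_on UNIV" by (auto simp: constant_on_def)
qed

section \<open>The angle condition\<close>

lemma radial_component:
  fixes x U :: "'a::real_inner"
  assumes "x \<noteq> 0"
  shows "(U \<bullet> grad (\<lambda>y. dist y 0) x)\<^sup>2 = (x \<bullet> U)\<^sup>2 / (norm x)\<^sup>2"
proof -
  have "grad (\<lambda>y. dist y 0) x = sgn x"
    using grad_eqI[OF GDERIV_norm[OF assms]] by simp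
  then show ?thesis by (simp add: sgn_div_norm power_mult_distrib power_divide inner_commute field_simps)
qed

theorem corollary11p9:
  fixes \<rho> p :: "real ^ 'n \<Rightarrow> real" and u :: "real ^ 'n \<Rightarrow> real ^ 'n"
  assumes "smooth \<rho>" and "smooth u" and "smooth p"
    and "\<And>x. \<rho> x \<ge> 0" and "\<And>x. p x > 0"
    and "steady_euler \<rho> u p"
  shows "(CARD('n) \<ge> 3 \<and>
            (\<forall>x. x \<noteq> 0 \<longrightarrow> (u x \<bullet> grad (\<lambda>y. dist y 0) x)\<^sup>2 \<le> 1/3 * (norm (u x))\<^sup>2)
              \<longrightarrow> hyperbolic (gas_tensor \<rho> u p)) \<and>
         (CARD('n) = 2 \<and>
            (\<forall>x. x \<noteq> 0 \<longrightarrow> (u x \<bullet> grad (\<lambda>y. dist y 0) x)\<^sup>2 \<ge> 1/2 * (norm (u x))\<^sup>2)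
              \<longrightarrow> parabolic (gas_tensor \<rho> u p))"
proof (intro conjI impI; elim conjE)
  assume "CARD('n) \<ge> 3"
    and angle: "\<forall>x. x \<noteq> 0 \<longrightarrow> (u x \<bullet> grad (\<lambda>y. dist y 0) x)\<^sup>2 \<le> 1/3 * (norm (u x))\<^sup>2"
  have "3 * (x \<bullet> u x)\<^sup>2 \<le> (norm x)\<^sup>2 * (norm (u x))\<^sup>2" for x
  proof (cases "x = 0")
    case False
    then have "(x \<bullet> u x)\<^sup>2 / (norm x)\<^sup>2 \<le> 1/3 * (norm (u x))\<^sup>2"
      using angle radial_component by metis
    then show ?thesis using False by (simp add: field_simps)
  qed simp
  then show "hyperbolic (gas_tensor \<rho> u p)"
    using \<open>CARD('n) \<ge> 3\<close> assms(5)[THEN less_imp_le]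
    by (intro hyperbolic_gas_tensor[OF assms(1-3,6,4)]) auto
next
  assume "CARD('n) = 2"
    and angle: "\<forall>x. x \<noteq> 0 \<longrightarrow> (u x \<bullet> grad (\<lambda>y. dist y 0) x)\<^sup>2 \<ge> 1/2 * (norm (u x))\<^sup>2"
  have "2 * (x \<bullet> u x)\<^sup>2 \<ge> (norm x)\<^sup>2 * (norm (u x))\<^sup>2" for x
  proof (cases "x = 0")
    case False
    then have "(x \<bullet> u x)\<^sup>2 / (norm x)\<^sup>2 \<ge> 1/2 * (norm (u x))\<^sup>2"
      using angle radial_component by metis
    then show ?thesis using False by (simp add: field_simps)
  qed simp
  then show "parabolic (gas_tensor \<rho> u p)"
    using \<open>CARD('n) = 2\<close> by (intro parabolic_gas_tensor[OF assms(1-3,6,4,5)]) auto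
qed

end
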